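(* Let $2\le m<\infty$. For every instance of the repair scheduling problem described in the context, the conversion algorithm described in the context has approximation bound $2-\frac1m$. That is, if $H^m$ is the cost of any $m$-crew schedule obtained by applying the conversion algorithm to an optimal single-crew repair sequence and $H^{m,\ast}$ is the minimum cost over all feasible $m$-crew schedules, then $$H^m\ \le\ \Big(2-\frac1m\Big)H^{m,\ast}.$$
   Context: Problem instance. A finite nonempty set $L$ of jobs (damaged edges of a radial, i.e. tree-shaped, distribution network with one source at the root) is given, with repair times $p_j \ge 0$ and positive weights $w_j$ for $j\in L$. The set $L$ is partitioned into nonempty groups called islands; $\mathcal{J}$ denotes the set of islands. A rooted tree $P$ on $\mathcal{J}$ is given, with edges directed away from the root (the group soft precedence graph). Write $J' \preceq_S J$ if $J'=J$ or $J'$ is an ancestor of $J$ in $P$. The weight of an island is $\omega_J := \sum_{j\in J} w_j$. Schedules. A feasible schedule on a given number of identical crews assigns each job to exactly one crew and gives it a start time $S_j\ge 0$, without preemption, each crew working on at most one job at a time. The completion time is $C_j=S_j+p_j$. Jobs may be started in any order: the tree $P$ does not restrict the order of repairs and enters only through energization times. The energization time of island $J$ is $E_J := \max_{J'\preceq_S J}\max_{j\in J'} C_j$. The cost of a schedule is $\sum_{J\in\mathcal{J}}\omega_J E_J$, to be minimized. A single-crew repair sequence is an ordering of $L$, processed by one crew from time $0$ without idle time; it is optimal if its cost is minimum over all feasible single-crew schedules. Conversion algorithm. Treat an optimal single-crew repair sequence as a priority list. Starting at time $0$, whenever one of the $m$ crews is free, assign to it the next job from the list; the first $m$ jobs are assigned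 arbitrarily to the $m$ crews. *)

theory Defs
  imports Complex_Main "HOL-Library.Disjoint_Sets"
begin

text \<open>Edges of \<open>P\<close> are directed away from the root: \<open>(u, v) \<in> P\<close> means that \<open>u\<close> is the parent of \<open>v\<close>.\<close>

definition rooted_tree :: "'v set \<Rightarrow> 'v rel \<Rightarrow> bool" where
  "rooted_tree V P \<longleftrightarrow>
     P \<subseteq> V \<times> V \<and>
     (\<exists>r\<in>V. (\<forall>v\<in>V. (r, v) \<in> P\<^sup>*) \<and> (\<forall>u\<in>V. (u, r) \<notin> P) \<and> (\<forall>v\<in>V - {r}. \<exists>!u. (u, v) \<in> P))"

definition repair_instance ::
    "'j set \<Rightarrow> ('j \<Rightarrow> real) \<Rightarrow> ('j \<Rightarrow> real) \<Rightarrow> 'j set set \<Rightarrow> 'j set rel \<Rightarrow> bool" where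
  "repair_instance L p w \<J> P \<longleftrightarrow>
     finite L \<and> L \<noteq> {} \<and> (\<forall>j\<in>L. 0 \<le> p j) \<and> (\<forall>j\<in>L. 0 < w j) \<and>
     partition_on L \<J> \<and> rooted_tree \<J> P"

text \<open>A schedule on crews \<open>0, \<dots>, m - 1\<close> is given by the crew \<open>c j\<close> and the start time \<open>S j\<close>
  of each job \<open>j\<close>.\<close>

definition feasible_schedule ::
    "'j set \<Rightarrow> ('j \<Rightarrow> real) \<Rightarrow> nat \<Rightarrow> ('j \<Rightarrow> nat) \<Rightarrow> ('j \<Rightarrow> real) \<Rightarrow> bool" where
  "feasible_schedule L p m c S \<longleftrightarrow>
     (\<forall>j\<in>L. c j < m \<and> 0 \<le> S j) \<and>
     (\<forall>i\<in>L. \<forall>j\<in>L. i \<noteq> j \<and> c i = c j \<longrightarrow> S i + p i \<le> S j \<or> S j + p j \<le> S i)"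

definition completion :: "('j \<Rightarrow> real) \<Rightarrow> ('j \<Rightarrow> real) \<Rightarrow> 'j \<Rightarrow> real" where
  "completion p S j = S j + p j"

text \<open>\<open>(J', J) \<in> P\<^sup>*\<close> holds iff \<open>J' = J\<close> or \<open>J'\<close> is an ancestor of \<open>J\<close>.\<close>

definition energization :: "'j set set \<Rightarrow> 'j set rel \<Rightarrow> ('j \<Rightarrow> real) \<Rightarrow> 'j set \<Rightarrow> real" where
  "energization \<J> P C J = Max ((\<lambda>J'. Max (C ` J')) ` {J' \<in> \<J>. (J', J) \<in> P\<^sup>*})"

definition schedule_cost ::
    "('j \<Rightarrow> real) \<Rightarrow> ('j \<Rightarrow> real) \<Rightarrow> 'j set set \<Rightarrow> 'j set rel \<Rightarrow> ('j \<Rightarrow> real) \<Rightarrow> real" where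
  "schedule_cost p w \<J> P S = (\<Sum>J\<in>\<J>. sum w J * energization \<J> P (completion p S) J)"

text \<open>The infimum below is over a set of nonnegative reals that is nonempty for \<open>m \<ge> 1\<close>. It is
  attained, since some feasible schedule without idle time is optimal and these have only finitely
  many costs.\<close>

definition min_cost ::
    "'j set \<Rightarrow> ('j \<Rightarrow> real) \<Rightarrow> ('j \<Rightarrow> real) \<Rightarrow> 'j set set \<Rightarrow> 'j set rel \<Rightarrow> nat \<Rightarrow> real" where
  "min_cost L p w \<J> P m = Inf {schedule_cost p w \<J> P S |c S. feasible_schedule L p m c S}"

definition repair_sequence :: "'j set \<Rightarrow> 'j list \<Rightarrow> bool" where
  "repair_sequence L xs \<longleftrightarrow> distinct xs \<and> set xs = L"

definition sequence_start :: "('j \<Rightarrow> real) \<Rightarrow> 'j list \<Rightarrow> 'j \<Rightarrow> real" where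
  "sequence_start p xs j = sum_list (map p (takeWhile (\<lambda>i. i \<noteq> j) xs))"

definition optimal_sequence ::
    "'j set \<Rightarrow> ('j \<Rightarrow> real) \<Rightarrow> ('j \<Rightarrow> real) \<Rightarrow> 'j set set \<Rightarrow> 'j set rel \<Rightarrow> 'j list \<Rightarrow> bool" where
  "optimal_sequence L p w \<J> P xs \<longleftrightarrow>
     repair_sequence L xs \<and>
     (\<forall>c S. feasible_schedule L p 1 c S \<longrightarrow>
        schedule_cost p w \<J> P (sequence_start p xs) \<le> schedule_cost p w \<J> P S)"

text \<open>\<open>list_run p m a xs c S\<close>: if crew \<open>k < m\<close> becomes free at time \<open>a k\<close>, then processing the
  priority list \<open>xs\<close> can produce the crew assignment \<open>c\<close> and the start times \<open>S\<close>. Each job goes to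
  a crew that is free earliest; ties are broken arbitrarily, so in particular the first \<open>m\<close> jobs
  may be distributed to the initially free crews in any order.\<close>

fun list_run ::
    "('j \<Rightarrow> real) \<Rightarrow> nat \<Rightarrow> (nat \<Rightarrow> real) \<Rightarrow> 'j list \<Rightarrow> ('j \<Rightarrow> nat) \<Rightarrow> ('j \<Rightarrow> real) \<Rightarrow> bool" where
  "list_run p m a [] c S \<longleftrightarrow> True"
| "list_run p m a (j # js) c S \<longleftrightarrow>
     c j < m \<and> (\<forall>k<m. a (c j) \<le> a k) \<and> S j = a (c j) \<and>
     list_run p m (a(c j := S j + p j)) js c S"

definition conversion_schedule ::
    "('j \<Rightarrow> real) \<Rightarrow> nat \<Rightarrow> 'j list \<Rightarrow> ('j \<Rightarrow> nat) \<Rightarrow> ('j \<Rightarrow> real) \<Rightarrow> bool" where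
  "conversion_schedule p m xs c S \<longleftrightarrow> list_run p m (\<lambda>_. 0) xs c S"

end

theory Submission
  imports Defs
begin

text \<open>Let \<open>C\<close> be the completion times of any \<open>m\<close>-crew schedule. Running the jobs on one crew in the
  order of \<open>C\<close> completes job \<open>j\<close> at time at most \<open>m * C j\<close>, because all jobs up to \<open>j\<close> are done by
  the \<open>m\<close> crews within \<open>[0, C j]\<close>; hence the optimal single-crew cost is at most \<open>m\<close> times the
  optimal \<open>m\<close>-crew cost. On the other hand, the conversion algorithm starts \<open>j\<close> no later than \<open>1/m\<close>
  times its single-crew start time, so its completion time is at most \<open>1/m\<close> times the single-crew
  one plus \<open>(1 - 1/m) * p j\<close>, where \<open>p j \<le> C j\<close>. Both bounds hold job by job and therefore
  pass to the energization times.\<close>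

text \<open>Reduces comparisons of energization times to comparisons of single jobs. Taking
  \<open>x\<close> to be the energization time itself gives the upper bound on each
  \<open>C j\<close>.\<close>

lemma energization_le_iff:
  assumes "finite L" "partition_on L \<J>" "J \<in> \<J>"
  shows "energization \<J> P C J \<le> x \<longleftrightarrow> (\<forall>J'\<in>\<J>. (J', J) \<in> P\<^sup>* \<longrightarrow> (\<forall>j\<in>J'. C j \<le> x))"
proof -
  have "finite \<J>"
    using finite_elements assms(1,2) .
  moreover have "finite J'" "J' \<noteq> {}" if "J' \<in> \<J>" for J'
    using that assms(1,2) by (auto simp: partition_on_def intro: finite_subset)
  moreover have "{J' \<in> \<J>. (J', J) \<in> P\<^sup>*} \<noteq> {}"
    using assms(3) by auto
  ultimately show ?thesis
    by (auto simp: energization_def)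
qed

text \<open>Induction removes a job with the latest start: if it has positive length, all others end
  before it starts, so its start time is the new horizon.\<close>

lemma sum_disjoint_intervals_le:
  fixes S p :: "'j \<Rightarrow> real"
  assumes "finite A" "0 \<le> T"
    and "\<And>j. j \<in> A \<Longrightarrow> 0 \<le> p j \<and> 0 \<le> S j \<and> S j + p j \<le> T"
    and "\<And>i j. i \<in> A \<Longrightarrow> j \<in> A \<Longrightarrow> i \<noteq> j \<Longrightarrow> S i + p i \<le> S j \<or> S j + p j \<le> S i"
  shows "sum p A \<le> T"
  using assms
proof (induction A arbitrary: T rule: finite_psubset_induct)
  case (psubset A)
  show ?case
  proof (cases "A = {}")
    case True
    then show ?thesis
      using psubset.prems by simp
  next
    case False
    have "Max (S ` A) \<in> S ` A"
      using False psubset.hyps by simp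
    then obtain j where j: "j \<in> A" "S j = Max (S ` A)"
      by auto
    have S_le: "S i \<le> S j" if "i \<in> A" for i
      using that psubset.hyps j(2) by simp
    have sub: "A - {j} \<subset> A"
      using j by auto
    \<comment> \<open>If \<open>p j = 0\<close>, another job may start at \<open>S j\<close> and end
      later, so the horizon stays at \<open>T\<close>; nothing is lost because \<open>j\<close>
      contributes no work.\<close>
    have "sum p (A - {j}) \<le> T - p j"
    proof (cases "p j = 0")
      case True
      have "sum p (A - {j}) \<le> T"
        using psubset.prems by (intro psubset.IH[OF sub]) auto
      then show ?thesis
        using True by simp
    next
      case False
      have "S i + p i \<le> S j" if "i \<in> A - {j}" for i
        using psubset.prems(2)[OF j(1)] psubset.prems(3)[of i j] S_le[of i] that j(1) False by force
      then have "sum p (A - {j}) \<le> S j"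
        using psubset.prems j(1) by (intro psubset.IH[OF sub]) auto
      then show ?thesis
        using psubset.prems(2)[OF j(1)] by linarith
    qed
    then show ?thesis
      using sum.remove[OF psubset.hyps j(1), of p] by linarith
  qed
qed

lemma feasible_schedule_work_le:
  assumes "finite L" "\<And>j. j \<in> L \<Longrightarrow> 0 \<le> p j" "feasible_schedule L p m c S" "0 \<le> T"
  shows "sum p {j \<in> L. completion p S j \<le> T} \<le> real m * T"
proof -
  let ?A = "{j \<in> L. completion p S j \<le> T}"
  have "sum p ?A = (\<Sum>k<m. sum p {j \<in> ?A. c j = k})"
    using assms(1,3) by (intro sum.group[symmetric]) (auto simp: feasible_schedule_def)
  also have "\<dots> \<le> (\<Sum>k<m. T)"
    using assms
    by (intro sum_mono sum_disjoint_intervals_le[where S = S])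
      (auto simp: feasible_schedule_def completion_def)
  finally show ?thesis
    by simp
qed

text \<open>The jobs run without idle time in increasing order of \<open>C\<close>. The bound counts
  every job tied with \<open>j\<close>, so it holds however ties are broken.\<close>

lemma ex_single_crew_schedule_by_key:
  fixes C :: "'j \<Rightarrow> real"
  assumes "finite L" "\<And>j. j \<in> L \<Longrightarrow> 0 \<le> p j"
  shows "\<exists>S. feasible_schedule L p 1 (\<lambda>_. 0) S \<and>
    (\<forall>j\<in>L. completion p S j \<le> sum p {i \<in> L. C i \<le> C j})"
proof -
  \<comment> \<open>The injection breaks ties in \<open>C\<close>, which makes \<open>before\<close>
    a strict total order on \<open>L\<close>.\<close>
  obtain f :: "'j \<Rightarrow> nat" where f: "inj_on f L"
    using finite_imp_inj_to_nat_seg[OF assms(1)] by auto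
  define before where "before i j \<longleftrightarrow> C i < C j \<or> C i = C j \<and> f i < f j" for i j
  define S where "S j = sum p {i \<in> L. before i j}" for j
  have total: "before i j \<or> before j i" if "i \<in> L" "j \<in> L" "i \<noteq> j" for i j
    using that inj_on_eq_iff[OF f that(1,2)] by (auto simp: before_def)
  have compl: "completion p S j = sum p (insert j {i \<in> L. before i j})" for j
    using assms(1) by (simp add: completion_def S_def before_def)
  \<comment> \<open>By transitivity, \<open>i\<close> and all its predecessors are among the
    predecessors of \<open>j\<close>.\<close>
  have ordered: "S i + p i \<le> S j" if "i \<in> L" "before i j" for i j
    unfolding completion_def[symmetric] compl S_def[of j]
    using that assms by (intro sum_mono2) (auto simp: before_def)
  have "0 \<le> S j" for j
    using assms(2) by (auto simp: S_def intro: sum_nonneg)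
  then have "feasible_schedule L p 1 (\<lambda>_. 0) S"
    using total ordered unfolding feasible_schedule_def by (metis zero_less_one)
  moreover have "completion p S j \<le> sum p {i \<in> L. C i \<le> C j}" if "j \<in> L" for j
    unfolding compl using that assms by (intro sum_mono2) (auto simp: before_def)
  ultimately show ?thesis
    by blast
qed

text \<open>Each scheduled job raises the sum of the crews' free times by exactly its repair time,
  and the next job starts at the smallest free time, hence no later than their average. The
  induction needs arbitrary initial free times \<open>a\<close>.\<close>

lemma list_run_start_le:
  assumes "list_run p m a xs c S" "j \<in> set xs"
  shows "real m * S j \<le> (\<Sum>k<m. a k) + sequence_start p xs j"
  using assms
proof (induction xs arbitrary: a)
  case Nil
  then show ?case
    by simp
next
  case (Cons x xs)
  show ?case
  proof (cases "j = x")
    case True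
    have "(\<Sum>k<m. a (c x)) \<le> (\<Sum>k<m. a k)"
      using Cons.prems(1) by (intro sum_mono) simp
    then show ?thesis
      using True Cons.prems(1) by (simp add: sequence_start_def)
  next
    case False
    define a' where "a' = a(c x := S x + p x)"
    have "(\<Sum>k<m. a' k) = (\<Sum>k<m. a k + (if k = c x then p x else 0))"
      using Cons.prems(1) by (intro sum.cong) (auto simp: a'_def)
    also have "\<dots> = (\<Sum>k<m. a k) + p x"
      using Cons.prems(1) by (simp add: sum.distrib)
    finally have "(\<Sum>k<m. a' k) = (\<Sum>k<m. a k) + p x" .
    moreover have "real m * S j \<le> (\<Sum>k<m. a' k) + sequence_start p xs j"
      using Cons.IH[of a'] Cons.prems False unfolding a'_def[symmetric] list_run.simps by auto
    ultimately show ?thesis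
      using False by (simp add: sequence_start_def)
  qed
qed

lemma optimal_sequence_cost_le:
  assumes inst: "repair_instance L p w \<J> P"
    and opt: "optimal_sequence L p w \<J> P xs"
    and feas: "feasible_schedule L p m c S"
  shows "schedule_cost p w \<J> P (sequence_start p xs) \<le> real m * schedule_cost p w \<J> P S"
proof -
  have L: "finite L" "\<And>j. j \<in> L \<Longrightarrow> 0 \<le> p j" "\<And>j. j \<in> L \<Longrightarrow> 0 < w j" "partition_on L \<J>"
    using inst by (auto simp: repair_instance_def)
  have J_sub: "J \<subseteq> L" if "J \<in> \<J>" for J
    using L(4) that by (auto simp: partition_on_def)
  note E_le_iff = energization_le_iff[OF L(1,4)]
  \<comment> \<open>The key is the completion time in the given \<open>m\<close>-crew schedule, so
    the jobs counted in the bound for \<open>j\<close> are those which the \<open>m\<close> crews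
    finish by \<open>completion p S j\<close>.\<close>
  obtain S1 where S1: "feasible_schedule L p 1 (\<lambda>_. 0) S1"
    "\<And>j. j \<in> L \<Longrightarrow> completion p S1 j \<le> sum p {i \<in> L. completion p S i \<le> completion p S j}"
    using ex_single_crew_schedule_by_key[of L p "completion p S"] L(1,2) by blast
  have S1_le: "completion p S1 j \<le> real m * completion p S j" if "j \<in> L" for j
  proof -
    have "0 \<le> completion p S j"
      using feas L(2) that by (auto simp: feasible_schedule_def completion_def)
    from feasible_schedule_work_le[OF L(1,2) feas this] S1(2)[OF that] show ?thesis
      by linarith
  qed
  have "energization \<J> P (completion p S1) J \<le> real m * energization \<J> P (completion p S) J"
    if J: "J \<in> \<J>" for J
    unfolding E_le_iff[OF J]
  proof (intro ballI impI)
    fix J' j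
    assume J': "J' \<in> \<J>" "(J', J) \<in> P\<^sup>*" "j \<in> J'"
    then have "completion p S j \<le> energization \<J> P (completion p S) J"
      using E_le_iff[OF J, of P "completion p S"] by blast
    then have "real m * completion p S j \<le> real m * energization \<J> P (completion p S) J"
      by (intro mult_left_mono) auto
    then show "completion p S1 j \<le> real m * energization \<J> P (completion p S) J"
      using S1_le[of j] J' J_sub by force
  qed
  moreover have "0 \<le> sum w J" if "J \<in> \<J>" for J
    using J_sub[OF that] L(3) by (intro sum_nonneg) (auto intro: less_imp_le)
  ultimately have "schedule_cost p w \<J> P S1 \<le> real m * schedule_cost p w \<J> P S"
    unfolding schedule_cost_def sum_distrib_left mult.left_commute[of "real m"]
    by (intro sum_mono mult_left_mono)
  moreover have "schedule_cost p w \<J> P (sequence_start p xs) \<le> schedule_cost p w \<J> P S1"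
    using opt S1(1) by (auto simp: optimal_sequence_def)
  ultimately show ?thesis
    by linarith
qed

text \<open>The excess \<open>(m - 1) * p j\<close> over the single-crew completion time is charged
  to the competing schedule \<open>S'\<close>, where \<open>j\<close> cannot complete before time
  \<open>p j\<close>.\<close>

lemma conversion_schedule_cost_le:
  assumes inst: "repair_instance L p w \<J> P" and "1 \<le> m"
    and seq: "repair_sequence L xs"
    and conv: "conversion_schedule p m xs c S"
    and feas: "feasible_schedule L p m c' S'"
  shows "real m * schedule_cost p w \<J> P S \<le>
    schedule_cost p w \<J> P (sequence_start p xs) + (real m - 1) * schedule_cost p w \<J> P S'"
proof -
  have L: "finite L" "\<And>j. j \<in> L \<Longrightarrow> 0 < w j" "partition_on L \<J>"
    using inst by (auto simp: repair_instance_def)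
  have J_sub: "J \<subseteq> L" if "J \<in> \<J>" for J
    using L(3) that by (auto simp: partition_on_def)
  note E_le_iff = energization_le_iff[OF L(1,3)]
  let ?E = "\<lambda>S. energization \<J> P (completion p S)"
  \<comment> \<open>The factor \<open>m\<close> is moved to the right so that the energization time
    stands alone, as \<open>energization_le_iff\<close> requires.\<close>
  have "?E S J \<le> (?E (sequence_start p xs) J + (real m - 1) * ?E S' J) / real m"
    if J: "J \<in> \<J>" for J
    unfolding E_le_iff[OF J]
  proof (intro ballI impI)
    fix J' j
    assume J': "J' \<in> \<J>" "(J', J) \<in> P\<^sup>*" "j \<in> J'"
    then have j: "j \<in> L"
      using J_sub by blast
    have "real m * S j \<le> sequence_start p xs j"
      using list_run_start_le[of p m "\<lambda>_. 0" xs c S j] conv seq j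
      by (simp add: conversion_schedule_def repair_sequence_def)
    then have "real m * completion p S j \<le> completion p (sequence_start p xs) j + (real m - 1) * p j"
      by (simp add: completion_def algebra_simps)
    also have "completion p (sequence_start p xs) j \<le> ?E (sequence_start p xs) J"
      using E_le_iff[OF J, of P "completion p (sequence_start p xs)"] J' by blast
    also have "(real m - 1) * p j \<le> (real m - 1) * ?E S' J"
    proof (intro mult_left_mono)
      have "p j \<le> completion p S' j"
        using feas j by (auto simp: feasible_schedule_def completion_def)
      also have "\<dots> \<le> ?E S' J"
        using E_le_iff[OF J, of P "completion p S'"] J' by blast
      finally show "p j \<le> ?E S' J" .
    qed (use \<open>1 \<le> m\<close> in simp)
    finally show "completion p S j \<le> (?E (sequence_start p xs) J + (real m - 1) * ?E S' J) / real m"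
      using \<open>1 \<le> m\<close> by (simp add: field_simps)
  qed
  moreover have "0 \<le> sum w J" if "J \<in> \<J>" for J
    using J_sub[OF that] L(2) by (intro sum_nonneg) (auto intro: less_imp_le)
  ultimately have "schedule_cost p w \<J> P S \<le>
      (\<Sum>J\<in>\<J>. sum w J * ((?E (sequence_start p xs) J + (real m - 1) * ?E S' J) / real m))"
    unfolding schedule_cost_def by (intro sum_mono mult_left_mono)
  also have "\<dots> = (schedule_cost p w \<J> P (sequence_start p xs) +
      (real m - 1) * schedule_cost p w \<J> P S') / real m"
    by (simp add: schedule_cost_def sum_distrib_left sum.distrib[symmetric] sum_divide_distrib
        distrib_left mult.left_commute)
  finally show ?thesis
    using \<open>1 \<le> m\<close> by (simp add: field_simps)
qed

theorem theorem4:
  fixes L :: "'j set" and p w :: "'j \<Rightarrow> real" and \<J> :: "'j set set" and P :: "'j set rel"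
    and m :: nat and xs :: "'j list" and c :: "'j \<Rightarrow> nat" and S :: "'j \<Rightarrow> real"
  assumes "2 \<le> m"
    and "repair_instance L p w \<J> P"
    and "optimal_sequence L p w \<J> P xs"
    and "conversion_schedule p m xs c S"
  shows "schedule_cost p w \<J> P S \<le> (2 - 1 / real m) * min_cost L p w \<J> P m"
proof -
  let ?H = "schedule_cost p w \<J> P" and ?r = "2 - 1 / real m"
  have r: "0 < ?r"
    using assms(1) by (simp add: field_simps)
  \<comment> \<open>Dividing by the positive ratio turns the claim into a lower bound for an
    infimum, to be checked against every feasible schedule.\<close>
  have "?H S / ?r \<le> min_cost L p w \<J> P m"
    unfolding min_cost_def
  proof (rule cInf_greatest)
    \<comment> \<open>A schedule that uses only crew \<open>0\<close> is feasible for
      \<open>m\<close> crews too; the key \<open>p\<close> is an arbitrary choice.\<close>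
    obtain S1 where "feasible_schedule L p 1 (\<lambda>_. 0) S1"
      using ex_single_crew_schedule_by_key[of L p p] assms(2)
      unfolding repair_instance_def by blast
    then have "feasible_schedule L p m (\<lambda>_. 0) S1"
      using assms(1) by (auto simp: feasible_schedule_def)
    then show "{?H S |c S. feasible_schedule L p m c S} \<noteq> {}"
      by blast
  next
    fix x
    assume "x \<in> {?H S |c S. feasible_schedule L p m c S}"
    then obtain c' S' where S': "feasible_schedule L p m c' S'" "x = ?H S'"
      by blast
    have "real m * ?H S \<le> ?H (sequence_start p xs) + (real m - 1) * x"
      using conversion_schedule_cost_le[OF assms(2) _ _ assms(4) S'(1)] assms(1,3) S'(2)
      by (simp add: optimal_sequence_def)
    also have "\<dots> \<le> real m * x + (real m - 1) * x"
      using optimal_sequence_cost_le[OF assms(2,3) S'(1)] S'(2) by simp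
    \<comment> \<open>The ratio arises here: \<open>m + (m - 1) = m * (2 - 1 / m)\<close>.\<close>
    also have "\<dots> = real m * (?r * x)"
      using assms(1) by (simp add: field_simps)
    finally have "?H S \<le> ?r * x"
      using assms(1) by simp
    then show "?H S / ?r \<le> x"
      using r by (simp add: pos_divide_le_eq mult.commute)
  qed
  then show ?thesis
    using r by (simp add: pos_divide_le_eq mult.commute)
qed

end
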